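(* Let $E$ be a regular Hausdorff topological space and let $(\mathcal{E}_n)_{n\in\mathbb{N}}$ be a sequence of sublinear expectations $\mathcal{E}_n\colon B_+(E)\to[0,\infty]$, with associated capacities $\mu_n(A)=\mathcal{E}_n(1_A)$, $A\in\mathcal{B}(E)$. For $f\in B(E)$ let $$\underline{\psi}(f)=\liminf_{n\to\infty}\frac1n\log\mathcal{E}_n(e^{nf}),\qquad\overline{\psi}(f)=\limsup_{n\to\infty}\frac1n\log\mathcal{E}_n(e^{nf}).$$ Let $\mathcal{H}$ be a nonempty set of continuous real-valued functions on $E$, let $\overline{\psi}^\ast_{\mathcal{H}}(x)=\sup_{f\in\mathcal{H}}\{f(x)-\overline{\psi}(f)\}$ for $x\in E$, and let $\mathscr{E}$ be the set of all $\mathcal{H}$-exposed points of $\overline{\psi}^\ast_{\mathcal{H}}$ which admit an exposing function $f\in\mathcal{H}$ such that $\underline{\psi}(f)=\overline{\psi}(f)$ and $f\in B_{\overline{\psi}}(E)$. Suppose that $(\mathcal{E}_n)_{n\in\mathbb{N}}$ is exponentially tight. Then: (i) For every closed set $C\subset E$, $$\limsup_{n\to\infty}\frac1n\log\mu_n(C)\le-\inf_{x\in C}\overline{\psi}^\ast_{\mathcal{H}}(x).$$ (ii) For every open set $O\subset E$, $$-\inf_{x\in O\cap\mathscr{E}}\overline{\psi}^\ast_{\mathcal{H}}(x)\le\liminf_{n\to\infty}\frac1n\log\mu_n(O).$$ (iii) If, moreover, $\inf_{x\in O}\overline{\psi}^\ast_{\mathcal{H}}(x)=\inf_{x\in O\cap\mathscr{E}}\overline{\psi}^\ast_{\mathcal{H}}(x)$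 for every open set $O\subset E$, then $(\mathcal{E}_n)_{n\in\mathbb{N}}$ satisfies the large deviation principle and the Laplace principle with rate function $\overline{\psi}^\ast_{\mathcal{H}}$.
   Context: Notation and conventions. $\mathcal{B}(E)$ is the Borel $\sigma$-algebra; $B(E)$ is the set of all Borel measurable $f\colon E\to\mathbb{R}\cup\{-\infty\}$; $B_+(E)$ is the set of all Borel measurable $f\colon E\to[0,\infty)$; $C(E)$ is the set of functions $f\colon E\to\mathbb{R}\cup\{-\infty\}$ that are both upper and lower semicontinuous. Conventions: $e^{-\infty}=0$, $\log0=-\infty$, $\log\infty=\infty$, $0\cdot\infty=0$, $\inf\emptyset=+\infty$. Sublinear expectation: a function $\mathcal{E}\colon B_+(E)\to[0,\infty]$ such that (1) $\mathcal{E}(c)=c$ for all constants $c\ge0$; (2) $\mathcal{E}(f)\le\mathcal{E}(g)$ whenever $f\le g$; (3) $\mathcal{E}(f+g)\le\mathcal{E}(f)+\mathcal{E}(g)$; (4) $\mathcal{E}(af)=a\mathcal{E}(f)$ for all constants $a\ge0$. $B_{\overline{\psi}}(E)=\{f\in B(E):\exists\,t>1,\ \overline{\psi}(tf)<\infty\}$ and $C_{\overline{\psi}}(E)=\{f\in C(E):\exists\,t>1,\ \overline{\psi}(tf)<\infty\}$. $\mathcal{H}$-exposed point: $x\in E$ is an $\mathcal{H}$-exposed point of $\overline{\psi}^\ast_{\mathcal{H}}$ if there is $f\in\mathcal{H}$ with $f(y)-\overline{\psi}^\ast_{\mathcal{H}}(y)<f(x)-\overline{\psi}^\ast_{\mathcal{H}}(x)$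 for all $y\neq x$; such an $f$ is an exposing function for $x$. Exponential tightness: for every $M\in\mathbb{N}$ there is a compact $K\subset E$ with $\limsup_{n\to\infty}\frac1n\log\mu_n(K^c)<-M$. Large deviation principle with rate function $I\colon E\to[0,\infty]$: for all $A\in\mathcal{B}(E)$, $-\inf_{x\in\mathrm{int}(A)}I(x)\le\liminf_{n\to\infty}\frac1n\log\mu_n(A)\le\limsup_{n\to\infty}\frac1n\log\mu_n(A)\le-\inf_{x\in\mathrm{cl}(A)}I(x)$. Laplace principle with rate function $I\colon E\to[0,\infty]$: $\lim_{n\to\infty}\frac1n\log\mathcal{E}_n(e^{nf})=\sup_{x\in E}\{f(x)-I(x)\}$ (the limit exists and equals the right-hand side) for all $f\in C_{\overline{\psi}}(E)$. *)

theory Defs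
  imports "HOL-Analysis.Analysis"
begin

text \<open>Functions \<open>E \<rightarrow> \<real> \<union> {-\<infinity>}\<close> are rendered as functions into \<^typ>\<open>ereal\<close> that never take the
  value \<open>\<infinity>\<close>; values in \<open>[0,\<infinity>]\<close> of a sublinear expectation are rendered in \<^typ>\<open>ennreal\<close>.\<close>

definition B_fun :: "('a::topological_space \<Rightarrow> ereal) set" where
  "B_fun = {f \<in> borel_measurable borel. \<forall>x. f x \<noteq> \<infinity>}"

definition B_plus :: "('a::topological_space \<Rightarrow> real) set" where
  "B_plus = {f \<in> borel_measurable borel. \<forall>x. 0 \<le> f x}"

definition upper_semicont :: "('a::topological_space \<Rightarrow> ereal) \<Rightarrow> bool" where
  "upper_semicont f \<longleftrightarrow> (\<forall>c. open {x. f x < c})"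

definition lower_semicont :: "('a::topological_space \<Rightarrow> ereal) \<Rightarrow> bool" where
  "lower_semicont f \<longleftrightarrow> (\<forall>c. open {x. c < f x})"

definition C_fun :: "('a::topological_space \<Rightarrow> ereal) set" where
  "C_fun = {f. (\<forall>x. f x \<noteq> \<infinity>) \<and> upper_semicont f \<and> lower_semicont f}"

text \<open>The exponential on \<open>\<real> \<union> {-\<infinity>}\<close>; the value at \<open>\<infinity>\<close> is a dummy.\<close>

definition exp_ereal :: "ereal \<Rightarrow> real" where
  "exp_ereal x = (case x of ereal r \<Rightarrow> exp r | PInfty \<Rightarrow> undefined | MInfty \<Rightarrow> 0)"

definition log_ennreal :: "ennreal \<Rightarrow> ereal" where
  "log_ennreal x = (if x = 0 then -\<infinity> else if x = \<infinity> then \<infinity> else ereal (ln (enn2real x)))"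

text \<open>A sublinear expectation is a functional on \<^const>\<open>B_plus\<close> only; its values at other functions
  are unconstrained.\<close>

definition sublinear_expectation :: "(('a::topological_space \<Rightarrow> real) \<Rightarrow> ennreal) \<Rightarrow> bool" where
  "sublinear_expectation \<E> \<longleftrightarrow>
     (\<forall>c\<ge>0. \<E> (\<lambda>_. c) = ennreal c) \<and>
     (\<forall>f\<in>B_plus. \<forall>g\<in>B_plus. (\<forall>x. f x \<le> g x) \<longrightarrow> \<E> f \<le> \<E> g) \<and>
     (\<forall>f\<in>B_plus. \<forall>g\<in>B_plus. \<E> (\<lambda>x. f x + g x) \<le> \<E> f + \<E> g) \<and>
     (\<forall>f\<in>B_plus. \<forall>a\<ge>0. \<E> (\<lambda>x. a * f x) = ennreal a * \<E> f)"

definition capacity :: "(('a \<Rightarrow> real) \<Rightarrow> ennreal) \<Rightarrow> 'a set \<Rightarrow> ennreal" where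
  "capacity \<E> A = \<E> (indicator A)"

text \<open>Sequences are indexed by \<^typ>\<open>nat\<close>; the term of index \<open>0\<close> below is irrelevant for the
  limits that are taken.\<close>

definition log_capacity :: "(nat \<Rightarrow> ('a \<Rightarrow> real) \<Rightarrow> ennreal) \<Rightarrow> 'a set \<Rightarrow> nat \<Rightarrow> ereal" where
  "log_capacity \<E> A n = ereal (1 / real n) * log_ennreal (capacity (\<E> n) A)"

definition log_expectation ::
    "(nat \<Rightarrow> ('a \<Rightarrow> real) \<Rightarrow> ennreal) \<Rightarrow> ('a \<Rightarrow> ereal) \<Rightarrow> nat \<Rightarrow> ereal" where
  "log_expectation \<E> f n =
     ereal (1 / real n) * log_ennreal (\<E> n (\<lambda>x. exp_ereal (ereal (real n) * f x)))"

definition lower_psi :: "(nat \<Rightarrow> ('a \<Rightarrow> real) \<Rightarrow> ennreal) \<Rightarrow> ('a \<Rightarrow> ereal) \<Rightarrow> ereal" where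
  "lower_psi \<E> f = liminf (log_expectation \<E> f)"

definition upper_psi :: "(nat \<Rightarrow> ('a \<Rightarrow> real) \<Rightarrow> ennreal) \<Rightarrow> ('a \<Rightarrow> ereal) \<Rightarrow> ereal" where
  "upper_psi \<E> f = limsup (log_expectation \<E> f)"

definition B_psi :: "(nat \<Rightarrow> ('a::topological_space \<Rightarrow> real) \<Rightarrow> ennreal) \<Rightarrow> ('a \<Rightarrow> ereal) set" where
  "B_psi \<E> = {f \<in> B_fun. \<exists>t::real. t > 1 \<and> upper_psi \<E> (\<lambda>x. ereal t * f x) < \<infinity>}"

definition C_psi :: "(nat \<Rightarrow> ('a::topological_space \<Rightarrow> real) \<Rightarrow> ennreal) \<Rightarrow> ('a \<Rightarrow> ereal) set" where
  "C_psi \<E> = {f \<in> C_fun. \<exists>t::real. t > 1 \<and> upper_psi \<E> (\<lambda>x. ereal t * f x) < \<infinity>}"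

definition psi_conj ::
    "(nat \<Rightarrow> ('a \<Rightarrow> real) \<Rightarrow> ennreal) \<Rightarrow> ('a \<Rightarrow> real) set \<Rightarrow> 'a \<Rightarrow> ereal" where
  "psi_conj \<E> H x = (SUP f\<in>H. ereal (f x) - upper_psi \<E> (\<lambda>y. ereal (f y)))"

definition exposing_function ::
    "(nat \<Rightarrow> ('a \<Rightarrow> real) \<Rightarrow> ennreal) \<Rightarrow> ('a \<Rightarrow> real) set \<Rightarrow> ('a \<Rightarrow> real) \<Rightarrow> 'a \<Rightarrow> bool" where
  "exposing_function \<E> H f x \<longleftrightarrow>
     f \<in> H \<and> (\<forall>y. y \<noteq> x \<longrightarrow> ereal (f y) - psi_conj \<E> H y < ereal (f x) - psi_conj \<E> H x)"

definition exposed_points ::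
    "(nat \<Rightarrow> ('a::topological_space \<Rightarrow> real) \<Rightarrow> ennreal) \<Rightarrow> ('a \<Rightarrow> real) set \<Rightarrow> 'a set" where
  "exposed_points \<E> H =
     {x. \<exists>f. exposing_function \<E> H f x \<and>
         lower_psi \<E> (\<lambda>y. ereal (f y)) = upper_psi \<E> (\<lambda>y. ereal (f y)) \<and>
         (\<lambda>y. ereal (f y)) \<in> B_psi \<E>}"

definition exponentially_tight ::
    "(nat \<Rightarrow> ('a::topological_space \<Rightarrow> real) \<Rightarrow> ennreal) \<Rightarrow> bool" where
  "exponentially_tight \<E> \<longleftrightarrow>
     (\<forall>M::nat. \<exists>K. compact K \<and> limsup (log_capacity \<E> (- K)) < - ereal (real M))"

text \<open>The requirement that a rate function takes values in \<open>[0,\<infinity>]\<close> is part of the two principles.\<close>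

definition large_deviation_principle ::
    "(nat \<Rightarrow> ('a::topological_space \<Rightarrow> real) \<Rightarrow> ennreal) \<Rightarrow> ('a \<Rightarrow> ereal) \<Rightarrow> bool" where
  "large_deviation_principle \<E> I \<longleftrightarrow>
     (\<forall>x. 0 \<le> I x) \<and>
     (\<forall>A\<in>sets borel.
        - (INF x\<in>interior A. I x) \<le> liminf (log_capacity \<E> A) \<and>
        liminf (log_capacity \<E> A) \<le> limsup (log_capacity \<E> A) \<and>
        limsup (log_capacity \<E> A) \<le> - (INF x\<in>closure A. I x))"

definition laplace_principle ::
    "(nat \<Rightarrow> ('a::topological_space \<Rightarrow> real) \<Rightarrow> ennreal) \<Rightarrow> ('a \<Rightarrow> ereal) \<Rightarrow> bool" where
  "laplace_principle \<E> I \<longleftrightarrow>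
     (\<forall>x. 0 \<le> I x) \<and>
     (\<forall>f\<in>C_psi \<E>. log_expectation \<E> f \<longlonglongrightarrow> (SUP x. f x - I x))"

end

theory Submission
  imports Defs
begin

text \<open>
  The argument rests on the fact that the functional \<open>\<psi>(f) = limsup (1/n) log \<E>\<^sub>n(e\<^bsup>nf\<^esup>)\<close> is monotone,
  commutes with the addition of constants, and is \<^emph>\<open>maxitive\<close>: \<open>\<psi>(f \<or> g) \<le> \<psi>(f) \<or> \<psi>(g)\<close>. Maxitivity is
  what sublinearity becomes on the logarithmic scale, because
  \<open>\<E>\<^sub>n(e\<^bsup>n(f \<or> g)\<^esup>) \<le> \<E>\<^sub>n(e\<^bsup>nf\<^esup>) + \<E>\<^sub>n(e\<^bsup>ng\<^esup>)\<close> and the factor \<open>2\<close> lost between the sum and the maximum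
  contributes only \<open>(ln 2)/n\<close>. Since the functions may take the
  value \<open>-\<infinity>\<close>, capacities are a special case: \<open>limsup (1/n) log \<mu>\<^sub>n(A)\<close> is \<open>\<psi>\<close> of the function that is
  \<open>0\<close> on \<open>A\<close> and \<open>-\<infinity>\<close> elsewhere. Below, \<^emph>\<open>cutting off\<close> \<open>f\<close> outside \<open>A\<close> means replacing \<open>f\<close> by \<open>-\<infinity>\<close>
  there.

  Write \<open>\<psi>\<^sup>*\<close> for the conjugate. The core is a strict upper bound of Varadhan type
  (\<open>upper_psi_cutoff_less\<close>): if \<open>f\<close> is upper semicontinuous with \<open>\<psi>(t f) < \<infinity>\<close> for some \<open>t > 1\<close>, \<open>C\<close> is
  closed and \<open>f - \<psi>\<^sup>* < s\<close> at each point of \<open>C\<close>, then \<open>f\<close> cut off outside \<open>C\<close> has \<open>\<psi> < s\<close>. At a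
  point \<open>y\<close> of \<open>C\<close> the definition of \<open>\<psi>\<^sup>*\<close> gives some \<open>g\<close> in \<open>H\<close> such that \<open>f < g - \<psi>(g) + a\<close>
  at \<open>y\<close>, with \<open>a < s\<close>; this persists on a neighbourhood of \<open>y\<close>, and the majorant has \<open>\<psi>\<close>-value
  \<open>a\<close>. Finitely many such majorants suffice on a compact set, outside of which exponential tightness and
  \<open>\<psi>(t f) < \<infinity>\<close> make the contribution negligible; maxitivity puts the pieces together.

  The bound for closed sets is the case \<open>f = 0\<close>. For the bound for open sets let \<open>f\<close> expose \<open>x\<close>. The
  strict upper bound, applied to the complement of a neighbourhood \<open>V\<close> of \<open>x\<close>, says that this complement
  contributes less than \<open>f(x) - \<psi>\<^sup>*(x) \<le> \<psi>(f)\<close> to \<open>\<psi>(f)\<close>. As the limit defining \<open>\<psi>(f)\<close>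
  exists, the whole of \<open>\<psi>(f)\<close> is carried by \<open>V\<close> (\<open>lower_psi_le_cutoff\<close>), even in the lower limit; on a
  small \<open>V\<close> the function \<open>f\<close> is at most \<open>f(x) + e\<close>, whence the capacity of \<open>V\<close> has rate at least
  \<open>-\<psi>\<^sup>*(x) - e\<close>. In this way exposing functions replace the change of measure of the classical
  proof. When the infima over \<open>U\<close> and over its exposed points agree, the two bounds are the large deviation
  principle; the upper half of the Laplace principle is again the Varadhan bound, now on the whole space, and
  the lower half follows by bounding \<open>f\<close> from below near each point.
\<close>

section \<open>Logarithm and exponential on the extended scale\<close>

lemma log_ennreal_mono:
  assumes "x \<le> y"
  shows "log_ennreal x \<le> log_ennreal y"
proof -
  have "ln (enn2real x) \<le> ln (enn2real y)" if "x \<noteq> 0" "y \<noteq> \<infinity>"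
  proof -
    have "x \<noteq> \<infinity>" using assms that by (auto simp: top_unique)
    with that(1) have "0 < enn2real x"
      by (simp add: enn2real_positive_iff less_top zero_less_iff_neq_zero)
    moreover have "enn2real x \<le> enn2real y"
      using assms that(2) by (simp add: enn2real_mono less_top)
    ultimately show ?thesis by simp
  qed
  moreover have "y \<noteq> 0" if "x \<noteq> 0" using assms that by auto
  ultimately show ?thesis using assms by (auto simp: log_ennreal_def top_unique)
qed

lemma log_ennreal_mult:
  assumes "0 < c"
  shows "log_ennreal (ennreal c * x) = ereal (ln c) + log_ennreal x"
proof (cases "x = 0 \<or> x = \<infinity>")
  case True
  then show ?thesis using assms by (auto simp: log_ennreal_def ennreal_mult_top)
next
  case False
  then obtain r where r: "x = ennreal r" "0 < r"
    by (cases x) (auto simp: less_le)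
  have "ennreal c * x = ennreal (c * r)" using r assms by (simp add: ennreal_mult)
  then show ?thesis using r assms
    by (simp add: log_ennreal_def ennreal_eq_0_iff ln_mult not_le)
qed

text \<open>On the logarithmic scale a sum is a maximum, up to an additive constant that disappears after
  division by \<open>n\<close>.\<close>

lemma log_ennreal_add_le:
  "log_ennreal (x + y) \<le> ereal (ln 2) + max (log_ennreal x) (log_ennreal y)"
proof -
  have "x + y \<le> max x y + max x y" by (intro add_mono) auto
  also have "\<dots> = ennreal 2 * max x y" by (simp add: mult_2)
  finally have "log_ennreal (x + y) \<le> ereal (ln 2) + log_ennreal (max x y)"
    using log_ennreal_mono log_ennreal_mult[of 2] by (metis zero_less_numeral)
  then show ?thesis using max_of_mono[of log_ennreal x y] by (simp add: monoI log_ennreal_mono)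
qed

lemma exp_ereal_measurable [measurable]: "exp_ereal \<in> borel_measurable borel"
proof -
  have "exp_ereal = (\<lambda>x. if x = -\<infinity> then 0 else if x = \<infinity> then undefined else exp (real_of_ereal x))"
    by (rule ext, case_tac x) (auto simp: exp_ereal_def)
  also have "\<dots> \<in> borel_measurable borel" by measurable
  finally show ?thesis .
qed

lemma exp_ereal_simps [simp]: "exp_ereal 0 = 1" "exp_ereal (-\<infinity>) = 0"
  by (simp_all add: exp_ereal_def zero_ereal_def)

lemma exp_ereal_nonneg: "x \<noteq> \<infinity> \<Longrightarrow> 0 \<le> exp_ereal x"
  by (cases x) (auto simp: exp_ereal_def)

lemma exp_ereal_mono: "x \<le> y \<Longrightarrow> y \<noteq> \<infinity> \<Longrightarrow> exp_ereal x \<le> exp_ereal y"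
  by (cases x; cases y) (auto simp: exp_ereal_def)

lemma exp_ereal_max_le:
  "x \<noteq> \<infinity> \<Longrightarrow> y \<noteq> \<infinity> \<Longrightarrow> exp_ereal (max x y) \<le> exp_ereal x + exp_ereal y"
  by (auto simp: max_def exp_ereal_nonneg)

lemma exp_ereal_add:
  "x \<noteq> \<infinity> \<Longrightarrow> exp_ereal (x + ereal c) = exp c * exp_ereal x"
  by (cases x) (auto simp: exp_ereal_def exp_add)

section \<open>Borel and semicontinuous functions\<close>

lemma B_fun_scale:
  assumes "f \<in> B_fun" "0 \<le> t"
  shows "(\<lambda>x. ereal t * f x) \<in> B_fun"
  using assms unfolding B_fun_def by (auto simp: ereal_mult_eq_PInfty)

lemma exp_scaled_in_B_plus:
  assumes "f \<in> B_fun"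
  shows "(\<lambda>x. exp_ereal (ereal (real n) * f x)) \<in> B_plus"
proof -
  have "(\<lambda>x. ereal (real n) * f x) \<in> B_fun" using B_fun_scale[OF assms] by simp
  then show ?thesis unfolding B_fun_def B_plus_def
    by (auto intro!: exp_ereal_nonneg)
qed

lemma B_fun_max:
  assumes "f \<in> B_fun" "g \<in> B_fun"
  shows "(\<lambda>x. max (f x) (g x)) \<in> B_fun"
  using assms unfolding B_fun_def by (auto simp: max_def)

lemma B_fun_add:
  assumes "f \<in> B_fun"
  shows "(\<lambda>x. f x + ereal c) \<in> B_fun"
  using assms unfolding B_fun_def by auto

lemma B_fun_const: "c \<noteq> \<infinity> \<Longrightarrow> (\<lambda>_. c) \<in> B_fun"
  by (simp add: B_fun_def)

lemma B_fun_continuous: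
  fixes f :: "'a::topological_space \<Rightarrow> real"
  assumes "continuous_on UNIV f"
  shows "(\<lambda>x. ereal (f x)) \<in> B_fun"
  using borel_measurable_continuous_onI[OF assms] by (simp add: B_fun_def)

lemma C_fun_subset_B_fun: "C_fun \<subseteq> B_fun"
  unfolding C_fun_def B_fun_def upper_semicont_def
  by (auto intro!: borel_measurable_iff_less[THEN iffD2] borel_measurableI_less)

lemma upper_semicont_continuous:
  fixes f :: "'a::topological_space \<Rightarrow> real"
  assumes "continuous_on UNIV f"
  shows "upper_semicont (\<lambda>x. ereal (f x))"
  unfolding upper_semicont_def
  by (intro allI open_Collect_less continuous_on_ereal continuous_on_const assms)

text \<open>Some real \<open>q\<close> lies strictly between \<open>f x\<close> and \<open>h x\<close>. This is
  what makes the domination of an upper semicontinuous function by a continuous one a local property.\<close>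

lemma open_upper_semicont_less:
  fixes f :: "'a::topological_space \<Rightarrow> ereal"
  assumes "upper_semicont f" "continuous_on UNIV h"
  shows "open {x. f x < ereal (h x)}"
proof -
  have "f x < ereal (h x) \<longleftrightarrow> (\<exists>q::real. f x < ereal q \<and> q < h x)" for x
    by (metis ereal_dense2 less_trans less_ereal.simps(1))
  then have "{x. f x < ereal (h x)} = (\<Union>q::real. {x. f x < ereal q} \<inter> {x. q < h x})"
    by auto
  also have "open \<dots>"
  proof (intro open_UN ballI open_Int)
    fix q :: real
    show "open {x. f x < ereal q}" using assms(1) by (simp add: upper_semicont_def)
    show "open {x. q < h x}" by (rule open_Collect_less[OF continuous_on_const assms(2)])
  qed
  finally show ?thesis .
qed

text \<open>The value \<open>-\<infinity>\<close> outside \<open>A\<close> turns \<open>e\<^bsup>nf\<^esup>\<close> into \<open>e\<^bsup>nf\<^esup>\<close> times the indicator of \<open>A\<close>; localising an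
  expectation and measuring a set thus become instances of the same functional.\<close>

definition cutoff :: "'a set \<Rightarrow> ('a \<Rightarrow> ereal) \<Rightarrow> 'a \<Rightarrow> ereal" where
  "cutoff A f = (\<lambda>x. if x \<in> A then f x else -\<infinity>)"

lemma cutoff_UNIV [simp]: "cutoff UNIV f = f"
  by (simp add: cutoff_def)

lemma B_fun_cutoff:
  assumes "f \<in> B_fun" "A \<in> sets borel"
  shows "cutoff A f \<in> B_fun"
  using assms unfolding B_fun_def cutoff_def by auto

lemma log_capacity_eq_log_expectation:
  "log_capacity \<E> A = log_expectation \<E> (cutoff A (\<lambda>_. 0))"
proof
  fix n :: nat
  show "log_capacity \<E> A n = log_expectation \<E> (cutoff A (\<lambda>_. 0)) n"
  proof (cases "n = 0")
    case False
    then have "(\<lambda>x. exp_ereal (ereal (real n) * cutoff A (\<lambda>_. 0) x)) = indicator A"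
      by (auto simp: cutoff_def indicator_def fun_eq_iff)
    then show ?thesis by (simp add: log_capacity_def log_expectation_def capacity_def)
  qed (simp add: log_capacity_def log_expectation_def flip: zero_ereal_def)
qed

section \<open>Maxitivity of the asymptotic functional\<close>

locale sublinear_sequence =
  fixes \<E> :: "nat \<Rightarrow> ('a::t3_space \<Rightarrow> real) \<Rightarrow> ennreal"
  assumes sublinear: "1 \<le> n \<Longrightarrow> sublinear_expectation (\<E> n)"
begin

lemma expectation_mono:
  assumes "1 \<le> n" "u \<in> B_plus" "v \<in> B_plus" "\<And>x. u x \<le> v x"
  shows "\<E> n u \<le> \<E> n v"
  using sublinear[OF assms(1)] assms(2-4) by (simp add: sublinear_expectation_def)

lemma expectation_add_le:
  assumes "1 \<le> n" "u \<in> B_plus" "v \<in> B_plus"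
  shows "\<E> n (\<lambda>x. u x + v x) \<le> \<E> n u + \<E> n v"
  using sublinear[OF assms(1)] assms(2-3) by (simp add: sublinear_expectation_def)

lemma log_expectation_mono:
  assumes "f \<in> B_fun" "g \<in> B_fun" "\<And>x. f x \<le> g x"
  shows "log_expectation \<E> f n \<le> log_expectation \<E> g n"
proof (cases "n = 0")
  case False
  have "exp_ereal (ereal (real n) * f x) \<le> exp_ereal (ereal (real n) * g x)" for x
    using assms B_fun_scale[OF assms(2), of "real n"]
    by (intro exp_ereal_mono ereal_mult_left_mono) (auto simp: B_fun_def)
  then have "\<E> n (\<lambda>x. exp_ereal (ereal (real n) * f x)) \<le> \<E> n (\<lambda>x. exp_ereal (ereal (real n) * g x))"
    using False by (intro expectation_mono exp_scaled_in_B_plus assms) auto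
  then show ?thesis unfolding log_expectation_def
    by (intro ereal_mult_left_mono log_ennreal_mono) auto
qed (simp add: log_expectation_def flip: zero_ereal_def)

lemma log_expectation_max_le:
  assumes "f \<in> B_fun" "g \<in> B_fun" "1 \<le> n"
  shows "log_expectation \<E> (\<lambda>x. max (f x) (g x)) n
    \<le> ereal (ln 2 / n) + max (log_expectation \<E> f n) (log_expectation \<E> g n)"
proof -
  let ?e = "\<lambda>f x. exp_ereal (ereal (real n) * f x)"
  have B: "?e f \<in> B_plus" "?e g \<in> B_plus" "?e (\<lambda>x. max (f x) (g x)) \<in> B_plus"
    using exp_scaled_in_B_plus B_fun_max assms by blast+
  then have B': "(\<lambda>x. ?e f x + ?e g x) \<in> B_plus"
    by (auto simp: B_plus_def)
  have mx: "ereal (real n) * max (f x) (g x) = max (ereal (real n) * f x) (ereal (real n) * g x)" for x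
    by (rule max_of_mono[symmetric]) (auto intro!: monoI ereal_mult_left_mono)
  have "?e (\<lambda>x. max (f x) (g x)) x \<le> ?e f x + ?e g x" for x
    unfolding mx using B_fun_scale[OF assms(1), of "real n"] B_fun_scale[OF assms(2), of "real n"]
    by (intro exp_ereal_max_le) (auto simp: B_fun_def)
  then have "\<E> n (?e (\<lambda>x. max (f x) (g x))) \<le> \<E> n (\<lambda>x. ?e f x + ?e g x)"
    by (intro expectation_mono assms B B')
  also have "\<dots> \<le> \<E> n (?e f) + \<E> n (?e g)"
    by (intro expectation_add_le assms B)
  finally have "log_ennreal (\<E> n (?e (\<lambda>x. max (f x) (g x))))
      \<le> ereal (ln 2) + max (log_ennreal (\<E> n (?e f))) (log_ennreal (\<E> n (?e g)))"
    using log_ennreal_mono log_ennreal_add_le order_trans by meson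
  then have "log_expectation \<E> (\<lambda>x. max (f x) (g x)) n
      \<le> ereal (1 / n) * (ereal (ln 2) + max (log_ennreal (\<E> n (?e f))) (log_ennreal (\<E> n (?e g))))"
    unfolding log_expectation_def by (intro ereal_mult_left_mono) auto
  also have "\<dots> = ereal (1 / n) * ereal (ln 2)
      + ereal (1 / n) * max (log_ennreal (\<E> n (?e f))) (log_ennreal (\<E> n (?e g)))"
    by (intro ereal_pos_distrib) auto
  also have "\<dots> \<le> ereal (ln 2 / n) + max (log_expectation \<E> f n) (log_expectation \<E> g n)"
    unfolding log_expectation_def by (auto simp: max_def intro!: add_mono)
  finally show ?thesis .
qed

lemma log_expectation_add_const:
  assumes "f \<in> B_fun" "1 \<le> n"
  shows "log_expectation \<E> (\<lambda>x. f x + ereal c) n = ereal c + log_expectation \<E> f n"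
proof -
  let ?e = "\<lambda>f x. exp_ereal (ereal (real n) * f x)"
  have "?e (\<lambda>x. f x + ereal c) x = exp (n * c) * ?e f x" for x
  proof -
    have "ereal (real n) * (f x + ereal c) = ereal (real n) * f x + ereal (n * c)"
      by (simp add: ereal_pos_distrib)
    moreover have "ereal (real n) * f x \<noteq> \<infinity>"
      using B_fun_scale[OF assms(1), of "real n"] by (auto simp: B_fun_def)
    ultimately show ?thesis by (metis exp_ereal_add)
  qed
  then have "\<E> n (?e (\<lambda>x. f x + ereal c)) = ennreal (exp (n * c)) * \<E> n (?e f)"
    using sublinear[OF assms(2)] exp_scaled_in_B_plus[OF assms(1)]
    by (simp add: sublinear_expectation_def)
  then have "log_expectation \<E> (\<lambda>x. f x + ereal c) n
      = ereal (1 / n) * (ereal (n * c) + log_ennreal (\<E> n (?e f)))"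
    by (simp add: log_expectation_def log_ennreal_mult)
  also have "\<dots> = ereal c + log_expectation \<E> f n"
    using assms(2) by (simp add: log_expectation_def ereal_pos_distrib)
  finally show ?thesis .
qed

lemma log_expectation_zero: "log_expectation \<E> (\<lambda>_. 0) = (\<lambda>_. 0)"
proof
  fix n
  show "log_expectation \<E> (\<lambda>_. 0) n = 0"
  proof (cases "n = 0")
    case False
    then have "\<E> n (\<lambda>_. 1) = 1"
      using sublinear[of n] by (simp add: sublinear_expectation_def)
    then show ?thesis
      by (simp add: log_expectation_def log_ennreal_def)
  qed (simp add: log_expectation_def flip: zero_ereal_def)
qed

lemma log_expectation_bot:
  assumes "1 \<le> n"
  shows "log_expectation \<E> (\<lambda>_. -\<infinity>) n = -\<infinity>"
proof -
  have "\<E> n (\<lambda>_. 0) = 0"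
    using sublinear[OF assms] unfolding sublinear_expectation_def by force
  then show ?thesis using assms
    by (simp add: log_expectation_def log_ennreal_def)
qed

lemma upper_psi_mono:
  assumes "f \<in> B_fun" "g \<in> B_fun" "\<And>x. f x \<le> g x"
  shows "upper_psi \<E> f \<le> upper_psi \<E> g"
  unfolding upper_psi_def using log_expectation_mono[OF assms] by (intro Limsup_mono) auto

lemma lower_psi_mono:
  assumes "f \<in> B_fun" "g \<in> B_fun" "\<And>x. f x \<le> g x"
  shows "lower_psi \<E> f \<le> lower_psi \<E> g"
  unfolding lower_psi_def using log_expectation_mono[OF assms] by (intro Liminf_mono) auto

lemma lower_psi_le_upper_psi: "lower_psi \<E> f \<le> upper_psi \<E> f"
  unfolding lower_psi_def upper_psi_def by (intro Liminf_le_Limsup) auto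

lemma upper_psi_add_const:
  assumes "f \<in> B_fun"
  shows "upper_psi \<E> (\<lambda>x. f x + ereal c) = ereal c + upper_psi \<E> f"
proof -
  have "upper_psi \<E> (\<lambda>x. f x + ereal c) = limsup (\<lambda>n. ereal c + log_expectation \<E> f n)"
    unfolding upper_psi_def
    by (intro Limsup_eq eventually_sequentiallyI[of 1]) (rule log_expectation_add_const[OF assms])
  then show ?thesis unfolding upper_psi_def by (simp add: Limsup_add_ereal_left)
qed

lemma lower_psi_add_const:
  assumes "f \<in> B_fun"
  shows "lower_psi \<E> (\<lambda>x. f x + ereal c) = ereal c + lower_psi \<E> f"
proof -
  have "lower_psi \<E> (\<lambda>x. f x + ereal c) = liminf (\<lambda>n. ereal c + log_expectation \<E> f n)"
    unfolding lower_psi_def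
    by (intro Liminf_eq eventually_sequentiallyI[of 1]) (rule log_expectation_add_const[OF assms])
  then show ?thesis unfolding lower_psi_def by (simp add: Liminf_add_ereal_left)
qed

lemma upper_psi_zero: "upper_psi \<E> (\<lambda>_. 0) = 0"
  by (simp add: upper_psi_def log_expectation_zero Limsup_const)

lemma lower_psi_zero: "lower_psi \<E> (\<lambda>_. 0) = 0"
  by (simp add: lower_psi_def log_expectation_zero Liminf_const)

lemma upper_psi_bot: "upper_psi \<E> (\<lambda>_. -\<infinity>) = -\<infinity>"
proof -
  have "upper_psi \<E> (\<lambda>_. -\<infinity>) = limsup (\<lambda>_. -\<infinity>)"
    unfolding upper_psi_def
    by (intro Limsup_eq eventually_sequentiallyI[of 1]) (rule log_expectation_bot)
  then show ?thesis by (simp add: Limsup_const)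
qed

lemma limsup_log_capacity: "limsup (log_capacity \<E> A) = upper_psi \<E> (cutoff A (\<lambda>_. 0))"
  by (simp add: upper_psi_def log_capacity_eq_log_expectation)

lemma liminf_log_capacity: "liminf (log_capacity \<E> A) = lower_psi \<E> (cutoff A (\<lambda>_. 0))"
  by (simp add: lower_psi_def log_capacity_eq_log_expectation)

lemma eventually_ln2_small:
  assumes "0 < (e::real)"
  shows "eventually (\<lambda>n. ln 2 / real n < e) sequentially"
proof -
  have "(\<lambda>n. ln 2 / real n) \<longlonglongrightarrow> 0"
    by (intro tendsto_divide_0[OF tendsto_const] filterlim_at_top_imp_at_infinity
        filterlim_real_sequentially)
  then show ?thesis using order_tendstoD(2) assms by blast
qed

text \<open>Maxitivity, stated with a strict bound because it is used to keep finitely many functions below a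
  common level.\<close>

lemma upper_psi_max_less:
  assumes "f \<in> B_fun" "g \<in> B_fun" "upper_psi \<E> f < s" "upper_psi \<E> g < s"
  shows "upper_psi \<E> (\<lambda>x. max (f x) (g x)) < s"
proof -
  obtain r' where r': "max (upper_psi \<E> f) (upper_psi \<E> g) < ereal r'" "ereal r' < s"
    using assms ereal_dense2[of "max (upper_psi \<E> f) (upper_psi \<E> g)" s] by auto
  obtain r where r: "max (upper_psi \<E> f) (upper_psi \<E> g) < ereal r" "r < r'"
    using ereal_dense2[OF r'(1)] by auto
  have "eventually (\<lambda>n. log_expectation \<E> f n < r) sequentially"
    "eventually (\<lambda>n. log_expectation \<E> g n < r) sequentially"
    using r(1) unfolding upper_psi_def by (auto intro: Limsup_lessD)
  moreover have "eventually (\<lambda>n. ln 2 / real n < r' - r) sequentially"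
    using r by (intro eventually_ln2_small) simp
  ultimately have "eventually (\<lambda>n. log_expectation \<E> (\<lambda>x. max (f x) (g x)) n \<le> r') sequentially"
    using eventually_ge_at_top[of 1]
  proof eventually_elim
    case (elim n)
    have "log_expectation \<E> (\<lambda>x. max (f x) (g x)) n
        \<le> ereal (ln 2 / n) + max (log_expectation \<E> f n) (log_expectation \<E> g n)"
      using log_expectation_max_le assms elim by blast
    also have "\<dots> \<le> ereal (r' - r) + ereal r"
      using elim by (intro add_mono) auto
    finally show ?case by simp
  qed
  then have "upper_psi \<E> (\<lambda>x. max (f x) (g x)) \<le> r'"
    unfolding upper_psi_def by (rule Limsup_bounded)
  with r' show ?thesis by simp
qed

lemma upper_psi_less_finite_majorant:
  assumes "finite F" "-\<infinity> < s" "\<And>h. h \<in> F \<Longrightarrow> h \<in> B_fun \<and> upper_psi \<E> h < s"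
  obtains k where "k \<in> B_fun" "upper_psi \<E> k < s" "\<And>h x. h \<in> F \<Longrightarrow> h x \<le> k x"
proof -
  have "\<exists>k. k \<in> B_fun \<and> upper_psi \<E> k < s \<and> (\<forall>h\<in>F. \<forall>x. h x \<le> k x)"
    using assms(1,3)
  proof (induction F)
    case empty
    show ?case using assms(2) upper_psi_bot B_fun_const[of "-\<infinity>"]
      by (intro exI[of _ "\<lambda>_. -\<infinity>"]) auto
  next
    case (insert h F)
    then obtain k where k: "k \<in> B_fun" "upper_psi \<E> k < s" "\<forall>h\<in>F. \<forall>x. h x \<le> k x" by auto
    show ?case
      using k insert.prems B_fun_max[of h k] upper_psi_max_less[of h k s]
      by (intro exI[of _ "\<lambda>x. max (h x) (k x)"]) (auto simp: le_max_iff_disj)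
  qed
  with that show ?thesis by blast
qed

text \<open>Principle of the largest term: at level \<open>n\<close> the functional of \<open>f\<close> is, up to \<open>(ln 2)/n\<close>, at most the
  maximum of the contributions of \<open>A\<close> and of its complement. If the complement stays strictly below the
  lower limit, the maximum is eventually attained on \<open>A\<close>.\<close>

lemma lower_psi_le_cutoff:
  assumes "f \<in> B_fun" "A \<in> sets borel" "upper_psi \<E> (cutoff (- A) f) < lower_psi \<E> f"
  shows "lower_psi \<E> f \<le> lower_psi \<E> (cutoff A f)"
  unfolding lower_psi_def[of \<E> "cutoff A f"] le_Liminf_iff
proof (intro allI impI)
  fix y assume "y < lower_psi \<E> f"
  then have "max y (upper_psi \<E> (cutoff (- A) f)) < lower_psi \<E> f" using assms(3) by simp
  \<comment> \<open>The gap \<open>r' - r\<close> absorbs the error \<open>(ln 2)/n\<close>.\<close>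
  then obtain r where r: "max y (upper_psi \<E> (cutoff (- A) f)) < ereal r" "r < lower_psi \<E> f"
    using ereal_dense2 by blast
  obtain r' where r': "r < r'" "ereal r' < lower_psi \<E> f"
    using ereal_dense2[OF r(2)] by auto
  have B: "cutoff A f \<in> B_fun" "cutoff (- A) f \<in> B_fun"
    using assms by (auto intro!: B_fun_cutoff)
  have eq: "(\<lambda>x. max (cutoff A f x) (cutoff (- A) f x)) = f"
    by (auto simp: cutoff_def fun_eq_iff)
  have "eventually (\<lambda>n. r' < log_expectation \<E> f n) sequentially"
    using r'(2) unfolding lower_psi_def by (rule less_LiminfD)
  moreover have "eventually (\<lambda>n. log_expectation \<E> (cutoff (- A) f) n < r) sequentially"
    using r(1) unfolding upper_psi_def by (auto intro: Limsup_lessD)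
  moreover have "eventually (\<lambda>n. ln 2 / real n < r' - r) sequentially"
    using r' by (intro eventually_ln2_small) simp
  ultimately show "eventually (\<lambda>n. y < log_expectation \<E> (cutoff A f) n) sequentially"
    using eventually_ge_at_top[of 1]
  proof eventually_elim
    case (elim n)
    have "\<not> log_expectation \<E> (cutoff A f) n \<le> r"
    proof
      assume "log_expectation \<E> (cutoff A f) n \<le> r"
      then have "ereal (ln 2 / n) + max (log_expectation \<E> (cutoff A f) n)
          (log_expectation \<E> (cutoff (- A) f) n) \<le> ereal (r' - r) + ereal r"
        using elim by (intro add_mono) auto
      then have "log_expectation \<E> f n \<le> r'"
        using log_expectation_max_le[OF B elim(4)] unfolding eq by simp
      with elim show False by simp
    qed
    with r show ?case by auto
  qed
qed

end

section \<open>The upper bound\<close>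

locale exponentially_tight_sequence = sublinear_sequence \<E>
  for \<E> :: "nat \<Rightarrow> ('a::t3_space \<Rightarrow> real) \<Rightarrow> ennreal" +
  fixes H :: "('a \<Rightarrow> real) set"
  assumes tight: "exponentially_tight \<E>"
    and H_continuous: "f \<in> H \<Longrightarrow> continuous_on UNIV f"
begin

lemma tight_compact:
  obtains K where "compact K" "upper_psi \<E> (cutoff (- K) (\<lambda>_. 0)) < ereal c"
proof -
  obtain M :: nat where M: "- c \<le> real M" using real_arch_simple by blast
  obtain K where K: "compact K" "limsup (log_capacity \<E> (- K)) < - ereal (real M)"
    using tight unfolding exponentially_tight_def by blast
  have "- ereal (real M) \<le> ereal c" using M by simp
  with K have "upper_psi \<E> (cutoff (- K) (\<lambda>_. 0)) < ereal c"
    unfolding limsup_log_capacity by (metis less_le_trans)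
  with K(1) that show ?thesis by blast
qed

text \<open>By tightness, the constant \<open>0\<close> is carried by some compact set, on which a continuous function is
  bounded below. Hence \<open>\<psi>(g)\<close> can be subtracted from \<open>g\<close> without producing \<open>\<infinity>\<close>.\<close>

lemma upper_psi_gt_MInf:
  assumes "continuous_on UNIV f"
  shows "-\<infinity> < upper_psi \<E> (\<lambda>x. ereal (f x))"
proof -
  obtain K where K: "compact K" "upper_psi \<E> (cutoff (- K) (\<lambda>_. 0)) < ereal 0"
    by (rule tight_compact)
  have [measurable]: "K \<in> sets borel" using K(1) by (simp add: compact_imp_closed)
  have B: "cutoff K (\<lambda>_. 0) \<in> B_fun" by (intro B_fun_cutoff B_fun_const) auto
  have "bounded (f ` K)"
    by (intro compact_imp_bounded compact_continuous_image K(1) continuous_on_subset[OF assms]) auto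
  then obtain m where m: "\<And>x. x \<in> K \<Longrightarrow> - m \<le> f x"
    unfolding bounded_real by (metis imageI abs_le_iff minus_le_iff)
  have "0 \<le> lower_psi \<E> (cutoff K (\<lambda>_. 0))"
    using lower_psi_le_cutoff[of "\<lambda>_. 0" K] K(2)
    by (simp add: B_fun_const lower_psi_zero flip: zero_ereal_def)
  also have "\<dots> \<le> upper_psi \<E> (cutoff K (\<lambda>_. 0))" by (rule lower_psi_le_upper_psi)
  finally have "ereal (- m) \<le> ereal (- m) + upper_psi \<E> (cutoff K (\<lambda>_. 0))"
    by (metis add.right_neutral add_left_mono)
  also have "\<dots> = upper_psi \<E> (\<lambda>x. cutoff K (\<lambda>_. 0) x + ereal (- m))"
    using upper_psi_add_const[OF B] by simp
  also have "\<dots> \<le> upper_psi \<E> (\<lambda>x. ereal (f x))"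
    using m by (intro upper_psi_mono B_fun_add B B_fun_continuous assms) (auto simp: cutoff_def)
  finally show ?thesis by (cases "upper_psi \<E> (\<lambda>x. ereal (f x))") auto
qed

text \<open>The Varadhan type bound. The hypothesis is pointwise, without a uniform gap below \<open>s\<close>; compactness
  supplies the gap, since only finitely many majorants are used. This strictness is what the
  lower bound at exposed points needs.\<close>

lemma upper_psi_cutoff_less:
  assumes f: "f \<in> B_psi \<E>" "upper_semicont f" and C: "closed C"
    and less: "\<And>y. y \<in> C \<Longrightarrow> f y - psi_conj \<E> H y < ereal s"
  shows "upper_psi \<E> (cutoff C f) < ereal s"
proof -
  obtain t where t: "1 < t" "upper_psi \<E> (\<lambda>x. ereal t * f x) < \<infinity>" and fB: "f \<in> B_fun"
    using f(1) unfolding B_psi_def by auto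
  have tfB: "(\<lambda>x. ereal t * f x) \<in> B_fun" using B_fun_scale[OF fB] t(1) by simp
  obtain q where q: "upper_psi \<E> (\<lambda>x. ereal t * f x) < ereal q"
    using ereal_dense2[OF t(2)] by auto
  \<comment> \<open>Where \<open>f > L\<close> one has \<open>f \<le> t f - (t - 1) L\<close>, and this \<open>L\<close> gives the right-hand side a
      \<open>\<psi>\<close>-value below \<open>s\<close>; where \<open>f \<le> L\<close>, a compact set \<open>K\<close> chosen for that \<open>L\<close> does so off \<open>K\<close>.\<close>
  define L where "L = (q - s) / (t - 1)"
  have L: "q - (t - 1) * L = s" using t(1) by (simp add: L_def)
  obtain K where K: "compact K" "upper_psi \<E> (cutoff (- K) (\<lambda>_. 0)) < ereal (s - L)"
    by (rule tight_compact)
  have KB: "cutoff (- K) (\<lambda>_. 0) \<in> B_fun"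
    using K(1) by (intro B_fun_cutoff B_fun_const) (auto simp: compact_imp_closed)
  define far where "far = (\<lambda>x. cutoff (- K) (\<lambda>_. 0) x + ereal L)"
  define high where "high = (\<lambda>x. ereal t * f x + ereal (- ((t - 1) * L)))"
  have far: "far \<in> B_fun" "upper_psi \<E> far < ereal s"
  proof -
    show "far \<in> B_fun" unfolding far_def by (intro B_fun_add KB)
    have "upper_psi \<E> far = ereal L + upper_psi \<E> (cutoff (- K) (\<lambda>_. 0))"
      unfolding far_def by (rule upper_psi_add_const[OF KB])
    then show "upper_psi \<E> far < ereal s"
      using K(2) by (cases "upper_psi \<E> (cutoff (- K) (\<lambda>_. 0))") auto
  qed
  have high: "high \<in> B_fun" "upper_psi \<E> high < ereal s"
  proof -
    show "high \<in> B_fun" unfolding high_def by (intro B_fun_add tfB)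
    have "upper_psi \<E> high = ereal (- ((t - 1) * L)) + upper_psi \<E> (\<lambda>x. ereal t * f x)"
      unfolding high_def by (rule upper_psi_add_const[OF tfB])
    then show "upper_psi \<E> high < ereal s"
      using q L by (cases "upper_psi \<E> (\<lambda>x. ereal t * f x)") auto
  qed
  have outside: "f x \<le> max (far x) (high x)" if "x \<notin> K" for x
  proof (cases "f x")
    case (real r)
    have "r \<le> t * r - (t - 1) * L" if "\<not> r \<le> L"
    proof -
      have "0 \<le> (t - 1) * (r - L)" using that t(1) by simp
      then show ?thesis by (simp add: algebra_simps)
    qed
    then show ?thesis using real that
      by (auto simp: far_def high_def cutoff_def le_max_iff_disj)
  qed (use fB in \<open>auto simp: B_fun_def\<close>)
  have "\<exists>h. continuous_on UNIV h \<and> upper_psi \<E> (\<lambda>x. ereal (h x)) < ereal s \<and> f y < ereal (h y)"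
    if y: "y \<in> C" for y
  proof -
    obtain a where a: "f y - psi_conj \<E> H y < ereal a" "a < s"
      using ereal_dense2[OF less[OF y]] by auto
    have "f y \<noteq> \<infinity>" using fB by (simp add: B_fun_def)
    then have "f y - ereal a < psi_conj \<E> H y"
      using a(1) by (cases "f y"; cases "psi_conj \<E> H y") auto
    then obtain g where g: "g \<in> H" "f y - ereal a < ereal (g y) - upper_psi \<E> (\<lambda>x. ereal (g x))"
      unfolding psi_conj_def less_SUP_iff by blast
    have gc: "continuous_on UNIV g" using H_continuous g(1) .
    obtain p where p: "upper_psi \<E> (\<lambda>x. ereal (g x)) = ereal p"
      using upper_psi_gt_MInf[OF gc] g(2) by (cases "upper_psi \<E> (\<lambda>x. ereal (g x))") auto
    \<comment> \<open>The shift is the one that gives \<open>h\<close> the \<open>\<psi>\<close>-value \<open>a\<close>.\<close>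
    define h where "h x = g x + (a - p)" for x
    have "upper_psi \<E> (\<lambda>x. ereal (h x)) = ereal a"
      using upper_psi_add_const[OF B_fun_continuous[OF gc], of "a - p"] p by (simp add: h_def)
    moreover have "continuous_on UNIV h" unfolding h_def by (intro continuous_intros gc)
    moreover have "f y < ereal (h y)"
      using g(2) p \<open>f y \<noteq> \<infinity>\<close> by (cases "f y") (auto simp: h_def)
    ultimately show ?thesis using a(2) by auto
  qed
  then obtain h where h: "\<And>y. y \<in> C \<Longrightarrow> continuous_on UNIV (h y)"
      "\<And>y. y \<in> C \<Longrightarrow> upper_psi \<E> (\<lambda>x. ereal (h y x)) < ereal s"
      "\<And>y. y \<in> C \<Longrightarrow> f y < ereal (h y y)"
    by metis
  have "compact (C \<inter> K)" using C K(1) by (simp add: closed_Int_compact)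
  then obtain D where D: "D \<subseteq> C \<inter> K" "finite D" "C \<inter> K \<subseteq> (\<Union>y\<in>D. {x. f x < ereal (h y x)})"
  proof (rule compactE_image)
    show "open {x. f x < ereal (h y x)}" if "y \<in> C \<inter> K" for y
      using open_upper_semicont_less[OF f(2) h(1)] that by simp
    show "C \<inter> K \<subseteq> (\<Union>y\<in>C \<inter> K. {x. f x < ereal (h y x)})" using h(3) by auto
  qed
  define F where "F = {far, high} \<union> (\<lambda>y x. ereal (h y x)) ` D"
  obtain k where k: "k \<in> B_fun" "upper_psi \<E> k < ereal s" "\<And>g x. g \<in> F \<Longrightarrow> g x \<le> k x"
  proof (rule upper_psi_less_finite_majorant[of F "ereal s"])
    show "g \<in> B_fun \<and> upper_psi \<E> g < ereal s" if "g \<in> F" for g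
      using that far high h(2) D(1) by (auto simp: F_def intro!: B_fun_continuous h(1))
  qed (use D(2) in \<open>auto simp: F_def\<close>)
  have "cutoff C f x \<le> k x" for x
  proof (cases "x \<in> C \<and> x \<in> K")
    case True
    then obtain y where y: "y \<in> D" "f x < ereal (h y x)" using D(3) by auto
    have "ereal (h y x) \<le> k x" using k(3)[of "\<lambda>x. ereal (h y x)"] y(1) by (auto simp: F_def)
    with y(2) True show ?thesis by (auto simp: cutoff_def)
  next
    case False
    then show ?thesis using outside[of x] k(3)[of far x] k(3)[of high x]
      by (auto simp: cutoff_def F_def le_max_iff_disj intro: order_trans)
  qed
  then have "upper_psi \<E> (cutoff C f) \<le> upper_psi \<E> k"
    using C fB k(1) by (intro upper_psi_mono B_fun_cutoff) auto
  with k(2) show ?thesis by simp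
qed

lemma upper_psi_cutoff_le:
  assumes "f \<in> B_psi \<E>" "upper_semicont f" "closed C"
  shows "upper_psi \<E> (cutoff C f) \<le> (SUP x\<in>C. f x - psi_conj \<E> H x)"
proof (rule ccontr)
  assume "\<not> ?thesis"
  then obtain s where s: "(SUP x\<in>C. f x - psi_conj \<E> H x) < ereal s"
      "ereal s < upper_psi \<E> (cutoff C f)"
    using ereal_dense2 by (metis not_le)
  have "upper_psi \<E> (cutoff C f) < ereal s"
  proof (rule upper_psi_cutoff_less[OF assms])
    show "f y - psi_conj \<E> H y < ereal s" if "y \<in> C" for y
      using SUP_upper[OF that, of "\<lambda>x. f x - psi_conj \<E> H x"] s(1) by (rule le_less_trans)
  qed
  with s(2) show False by simp
qed

lemma closed_upper_bound:
  assumes "closed C"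
  shows "limsup (log_capacity \<E> C) \<le> - (INF x\<in>C. psi_conj \<E> H x)"
proof -
  have "(\<lambda>_. 0) \<in> B_psi \<E>"
    by (auto simp: B_psi_def B_fun_const upper_psi_zero intro!: exI[of _ 2])
  moreover have "upper_semicont (\<lambda>_::'a. 0)" by (simp add: upper_semicont_def)
  ultimately have "limsup (log_capacity \<E> C) \<le> (SUP x\<in>C. 0 - psi_conj \<E> H x)"
    unfolding limsup_log_capacity using assms by (rule upper_psi_cutoff_le)
  then show ?thesis by (simp add: ereal_SUP_uminus_eq)
qed

section \<open>The lower bound at exposed points\<close>

text \<open>Since \<open>t > 1\<close>, the function \<open>f\<close> lies below \<open>0 \<or> t f\<close>.\<close>

lemma upper_psi_lt_PInf:
  assumes "f \<in> B_psi \<E>"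
  shows "upper_psi \<E> f < \<infinity>"
proof -
  obtain t where t: "1 < t" "upper_psi \<E> (\<lambda>x. ereal t * f x) < \<infinity>" and fB: "f \<in> B_fun"
    using assms unfolding B_psi_def by auto
  have tfB: "(\<lambda>x. ereal t * f x) \<in> B_fun" using B_fun_scale[OF fB] t(1) by simp
  have "f x \<le> max 0 (ereal t * f x)" for x
    using fB t(1) by (cases "f x") (auto simp: B_fun_def le_max_iff_disj zero_ereal_def mult_le_cancel_right1)
  then have "upper_psi \<E> f \<le> upper_psi \<E> (\<lambda>x. max 0 (ereal t * f x))"
    using fB tfB by (intro upper_psi_mono B_fun_max B_fun_const) auto
  also have "\<dots> < \<infinity>"
    using t(2) tfB by (intro upper_psi_max_less B_fun_const) (auto simp: upper_psi_zero)
  finally show ?thesis .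
qed

text \<open>By the strict upper bound, \<open>\<psi>(f)\<close> for an exposing function \<open>f\<close> is not reached away from
  \<open>x\<close>, so it is reached on every neighbourhood of \<open>x\<close>. Convergence is essential here: the complement
  is controlled through an upper limit, while the conclusion concerns a lower limit.\<close>

lemma exposed_point_lower_bound:
  assumes x: "x \<in> exposed_points \<E> H" "x \<in> U" and U: "open U"
  shows "- psi_conj \<E> H x \<le> liminf (log_capacity \<E> U)"
proof (cases "psi_conj \<E> H x = \<infinity>")
  case False
  obtain f where fH: "f \<in> H"
      and exposing: "\<And>y. y \<noteq> x \<Longrightarrow> ereal (f y) - psi_conj \<E> H y < ereal (f x) - psi_conj \<E> H x"
      and conv: "lower_psi \<E> (\<lambda>y. ereal (f y)) = upper_psi \<E> (\<lambda>y. ereal (f y))"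
      and fpsi: "(\<lambda>y. ereal (f y)) \<in> B_psi \<E>"
    using x(1) unfolding exposed_points_def exposing_function_def by blast
  let ?f = "\<lambda>y. ereal (f y)"
  have fc: "continuous_on UNIV f" using H_continuous fH .
  have fB: "?f \<in> B_fun" using fpsi by (simp add: B_psi_def)
  have conj_ge: "ereal (f x) - upper_psi \<E> ?f \<le> psi_conj \<E> H x"
    unfolding psi_conj_def using fH by (intro SUP_upper)
  obtain q where q: "upper_psi \<E> ?f = ereal q"
    using upper_psi_gt_MInf[OF fc] upper_psi_lt_PInf[OF fpsi] by (cases "upper_psi \<E> ?f") auto
  obtain p where p: "psi_conj \<E> H x = ereal p"
    using False conj_ge q by (cases "psi_conj \<E> H x") auto
  have pq: "f x - p \<le> q" using conj_ge p q by simp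
  show ?thesis
  proof (rule ereal_le_epsilon2)
    fix e :: real assume e: "0 < e"
    define V where "V = U \<inter> {y. f y < f x + e}"
    have V: "open V" "x \<in> V"
      using U x(2) e by (auto simp: V_def intro!: open_Int open_Collect_less continuous_intros fc)
    have VB: "cutoff V (\<lambda>_. 0) \<in> B_fun"
      using V(1) by (intro B_fun_cutoff B_fun_const) auto
    have "upper_psi \<E> (cutoff (- V) ?f) < ereal (f x - p)"
    proof (rule upper_psi_cutoff_less[OF fpsi upper_semicont_continuous[OF fc]])
      show "closed (- V)" using V(1) by (simp add: closed_Compl)
      show "?f y - psi_conj \<E> H y < ereal (f x - p)" if "y \<in> - V" for y
        using exposing[of y] that V(2) p by auto
    qed
    also have "\<dots> \<le> lower_psi \<E> ?f" using pq conv q by simp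
    finally have "lower_psi \<E> ?f \<le> lower_psi \<E> (cutoff V ?f)"
      using V(1) by (intro lower_psi_le_cutoff fB) auto
    also have "\<dots> \<le> lower_psi \<E> (\<lambda>y. cutoff V (\<lambda>_. 0) y + ereal (f x + e))"
      using V(1) by (intro lower_psi_mono B_fun_cutoff fB B_fun_add VB)
        (auto simp: cutoff_def V_def)
    also have "\<dots> = ereal (f x + e) + lower_psi \<E> (cutoff V (\<lambda>_. 0))"
      by (rule lower_psi_add_const[OF VB])
    also have "\<dots> \<le> ereal (f x + e) + lower_psi \<E> (cutoff U (\<lambda>_. 0))"
    proof (intro add_left_mono lower_psi_mono VB)
      show "cutoff U (\<lambda>_. 0) \<in> B_fun" using U by (intro B_fun_cutoff B_fun_const) auto
    qed (auto simp: cutoff_def V_def)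
    finally have "ereal (f x - p) \<le> ereal (f x + e) + lower_psi \<E> (cutoff U (\<lambda>_. 0))"
      using pq conv q by (metis ereal_less_eq(3) order_trans)
    then show "- psi_conj \<E> H x \<le> liminf (log_capacity \<E> U) + ereal e"
      unfolding liminf_log_capacity p by (cases "lower_psi \<E> (cutoff U (\<lambda>_. 0))") auto
  qed
qed simp

lemma open_lower_bound:
  assumes "open U"
  shows "- (INF x\<in>U \<inter> exposed_points \<E> H. psi_conj \<E> H x) \<le> liminf (log_capacity \<E> U)"
proof -
  have "- liminf (log_capacity \<E> U) \<le> (INF x\<in>U \<inter> exposed_points \<E> H. psi_conj \<E> H x)"
    using exposed_point_lower_bound[OF _ _ assms]
    by (intro INF_greatest) (simp add: ereal_uminus_le_reorder)
  then show ?thesis by (simp add: ereal_uminus_le_reorder)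
qed

section \<open>The large deviation and Laplace principles\<close>

context
  assumes exposed_dense: "open U \<Longrightarrow>
    (INF x\<in>U. psi_conj \<E> H x) = (INF x\<in>U \<inter> exposed_points \<E> H. psi_conj \<E> H x)"
begin

lemma open_lower_bound_full:
  assumes "open U"
  shows "- (INF x\<in>U. psi_conj \<E> H x) \<le> liminf (log_capacity \<E> U)"
  using open_lower_bound[OF assms] exposed_dense[OF assms] by simp

text \<open>The lower bound for the whole space, whose capacity is \<open>1\<close>.\<close>

lemma psi_conj_nonneg: "0 \<le> psi_conj \<E> H x"
proof -
  have "- (INF x. psi_conj \<E> H x) \<le> 0"
    using open_lower_bound_full[of UNIV] by (simp add: liminf_log_capacity lower_psi_zero)
  then have "0 \<le> (INF x. psi_conj \<E> H x)" by (simp add: ereal_uminus_le_reorder)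
  also have "\<dots> \<le> psi_conj \<E> H x" by (rule INF_lower) simp
  finally show ?thesis .
qed

lemma large_deviation_principle_psi_conj: "large_deviation_principle \<E> (psi_conj \<E> H)"
  unfolding large_deviation_principle_def
proof (intro conjI allI ballI)
  fix A :: "'a set" assume A: "A \<in> sets borel"
  have B: "cutoff D (\<lambda>_. 0) \<in> B_fun" if "D \<in> sets borel" for D :: "'a set"
    using that by (intro B_fun_cutoff B_fun_const) auto
  have "liminf (log_capacity \<E> (interior A)) \<le> liminf (log_capacity \<E> A)"
    unfolding liminf_log_capacity using A interior_subset[of A]
    by (intro lower_psi_mono B) (auto simp: cutoff_def)
  then show "- (INF x\<in>interior A. psi_conj \<E> H x) \<le> liminf (log_capacity \<E> A)"
    using open_lower_bound_full[OF open_interior] by (rule order_trans[rotated])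
  have "limsup (log_capacity \<E> A) \<le> limsup (log_capacity \<E> (closure A))"
    unfolding limsup_log_capacity using A closure_subset[of A]
    by (intro upper_psi_mono B) (auto simp: cutoff_def)
  then show "limsup (log_capacity \<E> A) \<le> - (INF x\<in>closure A. psi_conj \<E> H x)"
    using closed_upper_bound[OF closed_closure] by (rule order_trans)
  show "liminf (log_capacity \<E> A) \<le> limsup (log_capacity \<E> A)"
    by (intro Liminf_le_Limsup) simp
qed (rule psi_conj_nonneg)

text \<open>Near \<open>x\<close> the function \<open>f\<close> exceeds \<open>f x - e\<close>, so \<open>\<psi>\<close> of \<open>f\<close> is at least \<open>f x - e\<close> plus the rate of a
  neighbourhood of \<open>x\<close>. At points where \<open>f\<close> is \<open>-\<infinity>\<close> the nonnegativity of the conjugate rules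
  out the difference \<open>-\<infinity> - (-\<infinity>)\<close>, which is \<open>\<infinity>\<close> in \<^typ>\<open>ereal\<close>.\<close>

lemma laplace_lower_bound:
  assumes f: "f \<in> C_fun"
  shows "f x - psi_conj \<E> H x \<le> lower_psi \<E> f"
proof (cases "f x = -\<infinity>")
  case True
  then show ?thesis using psi_conj_nonneg[of x] by (cases "psi_conj \<E> H x") auto
next
  case False
  have fB: "f \<in> B_fun" using f C_fun_subset_B_fun by blast
  with False obtain r where r: "f x = ereal r" by (cases "f x") (auto simp: B_fun_def)
  show ?thesis
  proof (rule ereal_le_epsilon2)
    fix e :: real assume e: "0 < e"
    define U where "U = {y. ereal (r - e) < f y}"
    have U: "open U" "x \<in> U" using f e r by (auto simp: U_def C_fun_def lower_semicont_def)
    have UB: "cutoff U (\<lambda>_. 0) \<in> B_fun"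
      using U(1) by (intro B_fun_cutoff B_fun_const) auto
    have "- psi_conj \<E> H x \<le> - (INF y\<in>U. psi_conj \<E> H y)"
      using INF_lower[OF U(2), of "psi_conj \<E> H"] by simp
    also have "\<dots> \<le> lower_psi \<E> (cutoff U (\<lambda>_. 0))"
      using open_lower_bound_full[OF U(1)] by (simp add: liminf_log_capacity)
    finally have "ereal (r - e) + - psi_conj \<E> H x
        \<le> ereal (r - e) + lower_psi \<E> (cutoff U (\<lambda>_. 0))"
      by (rule add_left_mono)
    also have "\<dots> = lower_psi \<E> (\<lambda>y. cutoff U (\<lambda>_. 0) y + ereal (r - e))"
      using lower_psi_add_const[OF UB] by simp
    also have "\<dots> \<le> lower_psi \<E> f"
      by (intro lower_psi_mono B_fun_add UB fB) (auto simp: cutoff_def U_def)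
    finally show "f x - psi_conj \<E> H x \<le> lower_psi \<E> f + ereal e"
      unfolding r by (cases "psi_conj \<E> H x"; cases "lower_psi \<E> f") auto
  qed
qed

lemma laplace_principle_psi_conj: "laplace_principle \<E> (psi_conj \<E> H)"
  unfolding laplace_principle_def
proof (intro conjI allI ballI)
  fix f assume f: "f \<in> C_psi \<E>"
  then have fC: "f \<in> C_fun" and "f \<in> B_psi \<E>" "upper_semicont f"
    using C_fun_subset_B_fun by (auto simp: C_psi_def B_psi_def C_fun_def)
  then have "upper_psi \<E> f \<le> (SUP x. f x - psi_conj \<E> H x)"
    using upper_psi_cutoff_le[of f UNIV] by simp
  moreover have "(SUP x. f x - psi_conj \<E> H x) \<le> lower_psi \<E> f"
    by (intro SUP_least laplace_lower_bound fC)
  ultimately have "lower_psi \<E> f = (SUP x. f x - psi_conj \<E> H x)"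
      "upper_psi \<E> f = (SUP x. f x - psi_conj \<E> H x)"
    using lower_psi_le_upper_psi[of f] by auto
  then show "log_expectation \<E> f \<longlonglongrightarrow> (SUP x. f x - psi_conj \<E> H x)"
    unfolding lower_psi_def upper_psi_def by (intro Liminf_eq_Limsup) auto
qed (rule psi_conj_nonneg)

end

end

theorem theorem5p4:
  fixes \<E> :: "nat \<Rightarrow> ('a::t3_space \<Rightarrow> real) \<Rightarrow> ennreal"
    and H :: "('a \<Rightarrow> real) set"
  assumes "\<And>n. 1 \<le> n \<Longrightarrow> sublinear_expectation (\<E> n)"
    and "H \<noteq> {}"
    and "\<And>f. f \<in> H \<Longrightarrow> continuous_on UNIV f"
    and "exponentially_tight \<E>"
  shows "(\<forall>C. closed C \<longrightarrow>
            limsup (log_capacity \<E> C) \<le> - (INF x\<in>C. psi_conj \<E> H x)) \<and>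
         (\<forall>U. open U \<longrightarrow>
            - (INF x\<in>U \<inter> exposed_points \<E> H. psi_conj \<E> H x) \<le> liminf (log_capacity \<E> U)) \<and>
         ((\<forall>U. open U \<longrightarrow>
             (INF x\<in>U. psi_conj \<E> H x) = (INF x\<in>U \<inter> exposed_points \<E> H. psi_conj \<E> H x)) \<longrightarrow>
          large_deviation_principle \<E> (psi_conj \<E> H) \<and> laplace_principle \<E> (psi_conj \<E> H))"
proof -
  interpret exponentially_tight_sequence \<E> H
    by unfold_locales (use assms in auto)
  show ?thesis
    using closed_upper_bound open_lower_bound large_deviation_principle_psi_conj
      laplace_principle_psi_conj by blast
qed

end
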